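(* For each $N\ge 1$ let $A_N$ be a self-adjoint $N\times N$ matrix, let $e_N\in\mathbb C^N$ be a unit vector, let $B_Nf=\langle f,e_N\rangle e_N$ for $f\in\mathbb C^N$, and let $A_{N,\gamma}=A_N+\gamma B_N$ for $\gamma\in\mathbb C$. Let $$\mu_N(\gamma)=\max\{\operatorname{Im}(\lambda_{r,N,\gamma}):1\le r\le N\}$$ where $\gamma\in\mathbb C_+$ and $\{\lambda_{r,N,\gamma}\}_{r=1}^N$ are the eigenvalues of $A_{N,\gamma}$ repeated according to their algebraic multiplicities. Then $$\mu_N(\gamma)\ge\operatorname{Im}(\gamma)/N$$ for all $N\ge1$ and $\gamma\in\mathbb C_+$. Suppose in addition that there is a constant $c$ such that $\|A_N\|\le c$ for all $N$, and that the functions $$m_N(\lambda)=\langle(A_N-\lambda I_N)^{-1}e_N,e_N\rangle,\qquad \lambda\in\mathbb C_+,$$ converge to a function $m_\infty$ locally uniformly on $\mathbb C_+$ as $N\to\infty$. If $\gamma\in\mathbb C_+$ and $-1/\gamma\notin\operatorname{Ran}(m_\infty)$ then $$\lim_{N\to\infty}\mu_N(\gamma)=0.$$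
   Context: $\mathbb C_+=\{z\in\mathbb C:\operatorname{Im}(z)>0\}$; $\operatorname{Ran}(m_\infty)=m_\infty(\mathbb C_+)$; $I_N$ is the $N\times N$ identity matrix. Inner products are linear in the first variable. *)

theory Defs
  imports
    "HOL-Analysis.Analysis"
    "Jordan_Normal_Form.Schur_Decomposition"
    "Jordan_Normal_Form.Gauss_Jordan_Elimination"
begin

definition upper_half_plane :: "complex set" where
  "upper_half_plane = {z. Im z > 0}"

definition cvec_norm :: "complex Matrix.vec \<Rightarrow> real" where
  "cvec_norm v = sqrt (Re (v \<bullet>c v))"

(* The closed unit ball, rather than the unit sphere, keeps the supremum over a nonempty set
   in dimension 0. *)
definition mat_opnorm :: "complex mat \<Rightarrow> real" where
  "mat_opnorm M =
    (SUP v \<in> {v \<in> carrier_vec (dim_col M). cvec_norm v \<le> 1}. cvec_norm (M *\<^sub>v v))"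

definition eigvals_mset :: "complex mat \<Rightarrow> complex multiset" where
  "eigvals_mset M = proots (char_poly M)"

definition max_Im_eigval :: "complex mat \<Rightarrow> real" where
  "max_Im_eigval M = Max (set_mset (image_mset Im (eigvals_mset M)))"

definition locally_uniform_limit ::
    "complex set \<Rightarrow> (nat \<Rightarrow> complex \<Rightarrow> complex) \<Rightarrow> (complex \<Rightarrow> complex) \<Rightarrow> bool" where
  "locally_uniform_limit S f g \<longleftrightarrow>
    (\<forall>z\<in>S. \<exists>d>0. cball z d \<subseteq> S \<and> uniform_limit (cball z d) f g sequentially)"

lemma size_eigvals_mset:
  assumes "M \<in> carrier_mat n n"
  shows "size (eigvals_mset M) = n"
  using degree_monic_char_poly[OF assms] by (simp add: eigvals_mset_def size_proots_complex)

lemma cvec_norm_eq: "cvec_norm v = sqrt (\<Sum>i<dim_vec v. (cmod (v $ i))\<^sup>2)"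
proof -
  have "v \<bullet>c v = (\<Sum>i<dim_vec v. of_real ((cmod (v $ i))\<^sup>2))"
    by (auto simp: scalar_prod_def atLeast0LessThan complex_norm_square simp del: of_real_power
        intro!: sum.cong)
  thus ?thesis
    by (simp add: cvec_norm_def)
qed

(* The supremum in mat_opnorm is a genuine one. *)
lemma mat_opnorm_bdd_above:
  "bdd_above ((\<lambda>v. cvec_norm (M *\<^sub>v v)) ` {v \<in> carrier_vec (dim_col M). cvec_norm v \<le> 1})"
proof (rule bdd_aboveI2)
  fix v assume v: "v \<in> {v \<in> carrier_vec (dim_col M). cvec_norm v \<le> 1}"
  hence dv: "dim_vec v = dim_col M" by auto
  have le1: "cmod (v $ j) \<le> 1" if "j < dim_col M" for j
  proof -
    have "(cmod (v $ j))\<^sup>2 \<le> (\<Sum>i<dim_vec v. (cmod (v $ i))\<^sup>2)"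
      using that dv by (intro member_le_sum) auto
    also have "\<dots> \<le> 1"
      using v by (simp add: cvec_norm_eq)
    finally show ?thesis by (simp add: abs_square_le_1)
  qed
  have "cmod ((M *\<^sub>v v) $ i) \<le> (\<Sum>j<dim_col M. cmod (M $$ (i, j)))" if "i < dim_row M" for i
  proof -
    have "(M *\<^sub>v v) $ i = (\<Sum>j<dim_col M. M $$ (i, j) * v $ j)"
      using that dv by (simp add: scalar_prod_def atLeast0LessThan)
    also have "cmod \<dots> \<le> (\<Sum>j<dim_col M. cmod (M $$ (i, j)) * 1)"
      by (intro sum_norm_le) (use le1 in \<open>auto simp: norm_mult intro!: mult_left_le\<close>)
    finally show ?thesis by simp
  qed
  thus "cvec_norm (M *\<^sub>v v) \<le>
      sqrt (\<Sum>i<dim_row M. (\<Sum>j<dim_col M. cmod (M $$ (i, j)))\<^sup>2)"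
    unfolding cvec_norm_eq by (intro real_sqrt_le_mono) (auto intro!: sum_mono power_mono)
qed

end

theory Submission
  imports Defs
begin

text \<open>
  The lower bound is a trace argument. The eigenvalues of \<open>A + \<gamma>B\<close>, counted with algebraic
  multiplicity, add up to its trace, and \<open>tr A\<close> is real while \<open>tr B = \<parallel>e\<parallel>\<^sup>2 = 1\<close>. So their
  imaginary parts add up to \<open>Im \<gamma>\<close>, and the largest of the \<open>N\<close> imaginary parts is at least the
  average (\<open>sum_eigvals_eq_trace\<close>, \<open>max_Im_eigval_ge\<close>).

  For the limit, write \<open>m(z) = \<langle>(A - z)\<^sup>-\<^sup>1 e, e\<rangle>\<close>. An eigenvector \<open>f\<close> of \<open>A + \<gamma>B\<close> for an
  eigenvalue \<open>\<lambda>\<close> off the real line satisfies \<open>f = -\<gamma>\<langle>f, e\<rangle>(A - \<lambda>)\<^sup>-\<^sup>1 e\<close>. Pairing with \<open>e\<close> gives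
  \<open>m(\<lambda>) = -1/\<gamma>\<close> (\<open>resolvent_form_eigenvalue\<close>).
  Suppose that along some subsequence there are eigenvalues of imaginary part at least
  \<open>\<epsilon> > 0\<close>. They stay in a compact subset of the upper half-plane, because their moduli are at most
  \<open>c + \<bar>\<gamma>\<bar>\<close> (\<open>cmod_eigenvalue_le\<close>), so after refining the subsequence they converge to a point
  \<open>\<lambda>\<close> with \<open>Im \<lambda> \<ge> \<epsilon>\<close>. On the half-plane \<open>Im z \<ge> \<epsilon>\<close> all functions \<open>m\<^sub>N\<close> have the
  common Lipschitz constant \<open>1/\<epsilon>\<^sup>2\<close> (\<open>resolvent_form_Lipschitz\<close>); hence the values at the moving
  eigenvalues, all equal to \<open>-1/\<gamma>\<close>, converge to \<open>m\<^sub>\<infinity>(\<lambda>)\<close>. This puts \<open>-1/\<gamma>\<close> into the range of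
  \<open>m\<^sub>\<infinity>\<close>. If it is not there, the largest imaginary part is eventually below every \<open>\<epsilon> > 0\<close>,
  and it is nonnegative by the lower bound.
\<close>

section \<open>The Hermitian inner product\<close>

lemma cscalar_prod_self: "v \<bullet>c v = of_real ((cvec_norm v)\<^sup>2)"
proof -
  have "v \<bullet>c v = (\<Sum>i<dim_vec v. of_real ((cmod (v $ i))\<^sup>2))"
    by (auto simp: scalar_prod_def atLeast0LessThan complex_norm_square simp del: of_real_power
        intro!: sum.cong)
  thus ?thesis
    by (simp add: cvec_norm_eq sum_nonneg)
qed

lemma cvec_norm_nonneg [simp]: "cvec_norm v \<ge> 0"
  by (simp add: cvec_norm_eq sum_nonneg)

lemma cvec_norm_eq_0_iff:
  assumes "v \<in> carrier_vec n"
  shows "cvec_norm v = 0 \<longleftrightarrow> v = 0\<^sub>v n"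
  using conjugate_square_eq_0_vec[OF assms] by (simp add: cscalar_prod_self)

lemma cvec_norm_smult: "cvec_norm (k \<cdot>\<^sub>v v) = cmod k * cvec_norm v"
proof -
  have "(\<Sum>i<dim_vec v. (cmod ((k \<cdot>\<^sub>v v) $ i))\<^sup>2) = (cmod k)\<^sup>2 * (\<Sum>i<dim_vec v. (cmod (v $ i))\<^sup>2)"
    by (simp add: norm_mult power_mult_distrib sum_distrib_left)
  thus ?thesis
    by (simp add: cvec_norm_eq real_sqrt_mult)
qed

lemma cscalar_prod_commute:
  fixes v w :: "complex Matrix.vec"
  assumes "v \<in> carrier_vec n" "w \<in> carrier_vec n"
  shows "w \<bullet>c v = cnj (v \<bullet>c w)"
  using assms by (simp add: scalar_prod_def mult.commute)

lemma cscalar_prod_Cauchy_Schwarz: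
  assumes "v \<in> carrier_vec n" "w \<in> carrier_vec n"
  shows "cmod (v \<bullet>c w) \<le> cvec_norm v * cvec_norm w"
proof -
  have "cmod (v \<bullet>c w) \<le> (\<Sum>i<n. cmod (v $ i) * cmod (w $ i))"
    using assms by (auto simp: scalar_prod_def atLeast0LessThan norm_mult intro!: sum_norm_le)
  also have "\<dots> \<le> L2_set (\<lambda>i. cmod (v $ i)) {..<n} * L2_set (\<lambda>i. cmod (w $ i)) {..<n}"
    using L2_set_mult_ineq[of "\<lambda>i. cmod (v $ i)" "\<lambda>i. cmod (w $ i)" "{..<n}"] by simp
  also have "\<dots> = cvec_norm v * cvec_norm w"
    using assms by (simp add: cvec_norm_eq L2_set_def)
  finally show ?thesis .
qed

text \<open>
  Rescaling a nonzero \<open>v\<close> to norm one puts it into the unit ball over which the operator norm is the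
  supremum.
\<close>

lemma cvec_norm_mult_mat_vec_le:
  assumes M: "M \<in> carrier_mat m n" and v: "v \<in> carrier_vec n"
  shows "cvec_norm (M *\<^sub>v v) \<le> mat_opnorm M * cvec_norm v"
proof (cases "cvec_norm v = 0")
  case True
  hence "v = 0\<^sub>v n"
    using cvec_norm_eq_0_iff[OF v] by simp
  hence "M *\<^sub>v v = 0\<^sub>v m"
    using M by auto
  thus ?thesis
    using True cvec_norm_eq_0_iff[of "0\<^sub>v m" m] by simp
next
  case False
  hence pos: "cvec_norm v > 0"
    using cvec_norm_nonneg[of v] by linarith
  define k :: complex where "k = of_real (inverse (cvec_norm v))"
  have k: "cmod k = inverse (cvec_norm v)"
    by (simp add: k_def norm_inverse)
  have "cvec_norm (k \<cdot>\<^sub>v v) \<le> 1"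
    using pos by (simp add: cvec_norm_smult k)
  hence "cvec_norm (M *\<^sub>v (k \<cdot>\<^sub>v v)) \<le> mat_opnorm M"
    unfolding mat_opnorm_def using M v by (intro cSUP_upper mat_opnorm_bdd_above) auto
  also have "M *\<^sub>v (k \<cdot>\<^sub>v v) = k \<cdot>\<^sub>v (M *\<^sub>v v)"
    using M v by (rule mult_mat_vec)
  finally show ?thesis
    using pos by (simp add: cvec_norm_smult k field_simps)
qed

section \<open>Resolvents of self-adjoint matrices\<close>

lemma self_adjoint_entries:
  fixes A :: "complex mat"
  assumes A: "A \<in> carrier_mat n n" and sa: "mat_adjoint A = A" and ij: "i < n" "j < n"
  shows "A $$ (i, j) = cnj (A $$ (j, i))"
proof -
  have "A $$ (i, j) = mat_adjoint A $$ (i, j)"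
    using sa by simp
  also have "\<dots> = cnj (A $$ (j, i))"
    using A ij by (simp add: mat_adjoint_def mat_of_rows_def)
  finally show ?thesis .
qed

lemma self_adjoint_cscalar_prod:
  fixes A :: "complex mat"
  assumes A: "A \<in> carrier_mat n n" and sa: "mat_adjoint A = A"
    and v: "v \<in> carrier_vec n" and w: "w \<in> carrier_vec n"
  shows "(A *\<^sub>v v) \<bullet>c w = v \<bullet>c (A *\<^sub>v w)"
proof -
  have "(A *\<^sub>v v) \<bullet>c w = (\<Sum>i<n. \<Sum>j<n. A $$ (i, j) * v $ j * cnj (w $ i))"
    using A v w by (simp add: scalar_prod_def atLeast0LessThan sum_distrib_right)
  also have "\<dots> = (\<Sum>j<n. \<Sum>i<n. A $$ (i, j) * v $ j * cnj (w $ i))"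
    by (rule sum.swap)
  also have "\<dots> = (\<Sum>j<n. \<Sum>i<n. v $ j * cnj (A $$ (j, i) * w $ i))"
    by (intro sum.cong refl) (simp add: self_adjoint_entries[OF A sa, symmetric] mult_ac)
  also have "\<dots> = v \<bullet>c (A *\<^sub>v w)"
    using A v w by (simp add: scalar_prod_def atLeast0LessThan sum_distrib_left)
  finally show ?thesis .
qed

text \<open>
  Pair the equation with \<open>u\<close> and take imaginary parts: \<open>\<langle>Au, u\<rangle>\<close> is real, which leaves
  \<open>Im z \<parallel>u\<parallel>\<^sup>2 = - Im \<langle>f, u\<rangle>\<close>, and Cauchy-Schwarz bounds the right-hand side. This is the estimate
  \<open>\<parallel>(A - z)\<^sup>-\<^sup>1 f\<parallel> \<le> \<parallel>f\<parallel> / \<bar>Im z\<bar>\<close>, phrased through the equation that the resolvent solves, so that it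
  can also serve to prove that the inverse exists.
\<close>

lemma self_adjoint_resolvent_bound:
  fixes A :: "complex mat"
  assumes A: "A \<in> carrier_mat n n" and sa: "mat_adjoint A = A"
    and u: "u \<in> carrier_vec n" and f: "f \<in> carrier_vec n"
    and eq: "A *\<^sub>v u = z \<cdot>\<^sub>v u + f"
  shows "\<bar>Im z\<bar> * cvec_norm u \<le> cvec_norm f"
proof (cases "cvec_norm u = 0")
  case False
  have "(A *\<^sub>v u) \<bullet>c u = cnj ((A *\<^sub>v u) \<bullet>c u)"
    using self_adjoint_cscalar_prod[OF A sa u u] cscalar_prod_commute[of "A *\<^sub>v u" n u] A u
    by simp
  hence "Im ((A *\<^sub>v u) \<bullet>c u) = 0"
    by (metis complex_cnj_cancel_iff Reals_cnj_iff complex_is_Real_iff)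
  also have "(A *\<^sub>v u) \<bullet>c u = z * (u \<bullet>c u) + f \<bullet>c u"
    using u f by (simp add: eq add_scalar_prod_distrib[of _ n])
  finally have "Im z * (cvec_norm u)\<^sup>2 = - Im (f \<bullet>c u)"
    by (simp add: cscalar_prod_self)
  hence "\<bar>Im z\<bar> * (cvec_norm u)\<^sup>2 = \<bar>Im (f \<bullet>c u)\<bar>"
    by (metis abs_minus_cancel abs_mult abs_power2)
  also have "\<dots> \<le> cvec_norm f * cvec_norm u"
    using abs_Im_le_cmod cscalar_prod_Cauchy_Schwarz[OF f u] by (rule order_trans)
  finally have "(\<bar>Im z\<bar> * cvec_norm u) * cvec_norm u \<le> cvec_norm f * cvec_norm u"
    by (simp add: power2_eq_square mult_ac)
  thus ?thesis
    using False cvec_norm_nonneg[of u] by (simp add: mult_le_cancel_right)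
qed simp

lemma smult_mat_mult_vec:
  fixes M :: "'a :: comm_semiring_0 mat"
  assumes "M \<in> carrier_mat m n" "v \<in> carrier_vec n"
  shows "(k \<cdot>\<^sub>m M) *\<^sub>v v = k \<cdot>\<^sub>v (M *\<^sub>v v)"
  using assms by (intro eq_vecI) auto

lemma shifted_mat_vec:
  fixes A :: "complex mat"
  assumes "A \<in> carrier_mat n n" "u \<in> carrier_vec n"
  shows "(A - z \<cdot>\<^sub>m 1\<^sub>m n) *\<^sub>v u = A *\<^sub>v u - z \<cdot>\<^sub>v u"
  using assms by (subst minus_mult_distrib_mat_vec[of _ n n]) (auto simp: smult_mat_mult_vec[of _ n n])

text \<open>The resolvent bound with \<open>f = 0\<close> says that \<open>A - z\<close> has trivial kernel.\<close>

lemma self_adjoint_shift_inverse: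
  fixes A :: "complex mat"
  assumes A: "A \<in> carrier_mat n n" and sa: "mat_adjoint A = A" and z: "Im z \<noteq> 0"
  defines "S \<equiv> A - z \<cdot>\<^sub>m 1\<^sub>m n"
  defines "R \<equiv> the (mat_inverse S)"
  shows "R \<in> carrier_mat n n" "S * R = 1\<^sub>m n" "R * S = 1\<^sub>m n"
proof -
  have S: "S \<in> carrier_mat n n"
    unfolding S_def by (intro minus_carrier_mat smult_carrier_mat one_carrier_mat)
  have "det S \<noteq> 0"
  proof
    assume "det S = 0"
    then obtain v where v: "v \<in> carrier_vec n" "v \<noteq> 0\<^sub>v n" "S *\<^sub>v v = 0\<^sub>v n"
      using det_0_iff_vec_prod_zero_field[OF S] by blast
    have "A *\<^sub>v v = z \<cdot>\<^sub>v v + S *\<^sub>v v"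
      unfolding S_def shifted_mat_vec[OF A v(1)] using A v(1) by auto
    hence "\<bar>Im z\<bar> * cvec_norm v \<le> cvec_norm (0\<^sub>v n)"
      using self_adjoint_resolvent_bound[OF A sa v(1)] v(3) by simp
    also have "\<dots> = 0"
      using cvec_norm_eq_0_iff[of "0\<^sub>v n" n] by simp
    finally have "cvec_norm v = 0"
      using z cvec_norm_nonneg[of v] by (simp add: mult_le_0_iff)
    thus False
      using v cvec_norm_eq_0_iff by blast
  qed
  hence "mat_inverse S \<noteq> None"
    using det_non_zero_imp_unit[OF S, of "()"] mat_inverse(1)[OF S, of "()"] by blast
  hence "mat_inverse S = Some R"
    by (simp add: R_def)
  thus "R \<in> carrier_mat n n" "S * R = 1\<^sub>m n" "R * S = 1\<^sub>m n"
    using mat_inverse(2)[OF S] by blast+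
qed

text \<open>
  This is the function \<open>z \<mapsto> \<langle>(A - z)\<^sup>-\<^sup>1 e, e\<rangle>\<close>; \<open>A\<close> is meant to be square.
\<close>

definition resolvent_form :: "complex mat \<Rightarrow> complex Matrix.vec \<Rightarrow> complex \<Rightarrow> complex" where
  "resolvent_form A e z = (the (mat_inverse (A - z \<cdot>\<^sub>m 1\<^sub>m (dim_row A))) *\<^sub>v e) \<bullet>c e"

lemma resolvent_vec_unique:
  fixes A :: "complex mat"
  assumes A: "A \<in> carrier_mat n n" and sa: "mat_adjoint A = A" and z: "Im z \<noteq> 0"
    and u: "u \<in> carrier_vec n" and eq: "A *\<^sub>v u - z \<cdot>\<^sub>v u = f"
  shows "the (mat_inverse (A - z \<cdot>\<^sub>m 1\<^sub>m n)) *\<^sub>v f = u"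
proof -
  let ?S = "A - z \<cdot>\<^sub>m 1\<^sub>m n" and ?R = "the (mat_inverse (A - z \<cdot>\<^sub>m 1\<^sub>m n))"
  note R = self_adjoint_shift_inverse[OF A sa z]
  have S: "?S \<in> carrier_mat n n"
    by (intro minus_carrier_mat smult_carrier_mat one_carrier_mat)
  have "?R *\<^sub>v f = ?R *\<^sub>v (?S *\<^sub>v u)"
    by (simp only: shifted_mat_vec[OF A u] eq)
  also have "\<dots> = (?R * ?S) *\<^sub>v u"
    using assoc_mult_mat_vec[OF R(1) S u] by simp
  also have "\<dots> = u"
    using R(3) u by simp
  finally show ?thesis .
qed

lemma resolvent_vecE:
  fixes A :: "complex mat"
  assumes A: "A \<in> carrier_mat n n" and sa: "mat_adjoint A = A" and z: "Im z \<noteq> 0"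
    and e: "e \<in> carrier_vec n"
  obtains u where "u \<in> carrier_vec n" "A *\<^sub>v u = z \<cdot>\<^sub>v u + e" "resolvent_form A e z = u \<bullet>c e"
proof -
  let ?S = "A - z \<cdot>\<^sub>m 1\<^sub>m n" and ?R = "the (mat_inverse (A - z \<cdot>\<^sub>m 1\<^sub>m n))"
  note R = self_adjoint_shift_inverse[OF A sa z]
  have S: "?S \<in> carrier_mat n n"
    by (intro minus_carrier_mat smult_carrier_mat one_carrier_mat)
  define u where "u = ?R *\<^sub>v e"
  have u: "u \<in> carrier_vec n"
    using R(1) e by (simp add: u_def)
  have "?S *\<^sub>v u = e"
    unfolding u_def using assoc_mult_mat_vec[OF S R(1) e] R(2) e by simp
  hence "A *\<^sub>v u - z \<cdot>\<^sub>v u = e"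
    by (simp add: shifted_mat_vec[OF A u])
  moreover have "A *\<^sub>v u = z \<cdot>\<^sub>v u + (A *\<^sub>v u - z \<cdot>\<^sub>v u)"
    using A u by auto
  ultimately have "A *\<^sub>v u = z \<cdot>\<^sub>v u + e"
    by simp
  moreover have "resolvent_form A e z = u \<bullet>c e"
    using A by (simp add: resolvent_form_def u_def)
  ultimately show thesis
    using that u by blast
qed

text \<open>
  The vectors \<open>u = (A - z)\<^sup>-\<^sup>1 e\<close> and \<open>v = (A - w)\<^sup>-\<^sup>1 e\<close> satisfy the resolvent identity
  \<open>(A - z)(u - v) = (z - w) v\<close>. Applying the resolvent bound to it, and then to \<open>v\<close>, costs one factor
  \<open>1/\<epsilon>\<close> each. The constant does not involve \<open>A\<close>, \<open>e\<close> or the dimension: this uniformity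
  is what allows the limit to be taken at moving points.
\<close>

lemma resolvent_form_Lipschitz:
  fixes A :: "complex mat"
  assumes A: "A \<in> carrier_mat n n" and sa: "mat_adjoint A = A"
    and e: "e \<in> carrier_vec n" and unit: "cvec_norm e = 1"
    and z: "\<epsilon> \<le> Im z" and w: "\<epsilon> \<le> Im w" and \<epsilon>: "\<epsilon> > 0"
  shows "cmod (resolvent_form A e z - resolvent_form A e w) \<le> cmod (z - w) / \<epsilon>\<^sup>2"
proof -
  obtain u where u: "u \<in> carrier_vec n" "A *\<^sub>v u = z \<cdot>\<^sub>v u + e" "resolvent_form A e z = u \<bullet>c e"
    using resolvent_vecE[OF A sa _ e, of z] z \<epsilon> by auto
  obtain v where v: "v \<in> carrier_vec n" "A *\<^sub>v v = w \<cdot>\<^sub>v v + e" "resolvent_form A e w = v \<bullet>c e"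
    using resolvent_vecE[OF A sa _ e, of w] w \<epsilon> by auto
  have "A *\<^sub>v (u - v) = A *\<^sub>v u - A *\<^sub>v v"
    using A u(1) v(1) by (rule mult_minus_distrib_mat_vec)
  also have "\<dots> = z \<cdot>\<^sub>v (u - v) + (z - w) \<cdot>\<^sub>v v"
    unfolding u(2) v(2) using u(1) v(1) e by (intro eq_vecI) (auto simp: algebra_simps)
  finally have "\<bar>Im z\<bar> * cvec_norm (u - v) \<le> cvec_norm ((z - w) \<cdot>\<^sub>v v)"
    using self_adjoint_resolvent_bound[OF A sa] u(1) v(1) by simp
  hence "\<epsilon> * cvec_norm (u - v) \<le> cmod (z - w) * cvec_norm v"
    using mult_right_mono[of \<epsilon> "\<bar>Im z\<bar>" "cvec_norm (u - v)"] z \<epsilon> by (simp add: cvec_norm_smult)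
  moreover have "\<epsilon> * cvec_norm v \<le> 1"
    using self_adjoint_resolvent_bound[OF A sa v(1) e v(2)] unit w \<epsilon>
      mult_right_mono[of \<epsilon> "\<bar>Im w\<bar>" "cvec_norm v"] by simp
  hence "cmod (z - w) * (\<epsilon> * cvec_norm v) \<le> cmod (z - w) * 1"
    by (intro mult_left_mono) auto
  moreover have "\<epsilon> * (\<epsilon> * cvec_norm (u - v)) \<le> \<epsilon> * (cmod (z - w) * cvec_norm v)"
    using calculation(1) \<epsilon> by (intro mult_left_mono) auto
  ultimately have "\<epsilon> * (\<epsilon> * cvec_norm (u - v)) \<le> cmod (z - w)"
    by (simp add: mult_ac)
  hence "cvec_norm (u - v) \<le> cmod (z - w) / \<epsilon>\<^sup>2"
    using \<epsilon> by (simp add: field_simps power2_eq_square)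
  moreover have "resolvent_form A e z - resolvent_form A e w = (u - v) \<bullet>c e"
    using u v e by (simp add: minus_scalar_prod_distrib[of _ n])
  hence "cmod (resolvent_form A e z - resolvent_form A e w) \<le> cvec_norm (u - v)"
    using cscalar_prod_Cauchy_Schwarz[of "u - v" n e] u(1) v(1) e unit by simp
  ultimately show ?thesis
    by linarith
qed

section \<open>Eigenvalues\<close>

lemma eigvals_mset_iff_eigenvalue:
  assumes M: "M \<in> carrier_mat n n"
  shows "l \<in># eigvals_mset M \<longleftrightarrow> eigenvalue M l"
proof -
  have "char_poly M \<noteq> 0"
    using degree_monic_char_poly[OF M] by auto
  thus ?thesis
    using eigenvalue_root_char_poly[OF M] by (simp add: eigvals_mset_def)
qed

lemma Im_eigval_le_max:
  assumes "l \<in># eigvals_mset M"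
  shows "Im l \<le> max_Im_eigval M"
  using assms by (simp add: max_Im_eigval_def)

lemma max_Im_eigval_attained:
  assumes M: "M \<in> carrier_mat n n" and n: "n \<ge> 1"
  obtains l where "eigenvalue M l" "Im l = max_Im_eigval M"
proof -
  have "eigvals_mset M \<noteq> {#}"
    using size_eigvals_mset[OF M] n by auto
  hence "max_Im_eigval M \<in> Im ` set_mset (eigvals_mset M)"
    unfolding max_Im_eigval_def set_image_mset by (intro Max_in) auto
  thus thesis
    using that eigvals_mset_iff_eigenvalue[OF M] by auto
qed

lemma sum_diag_mult_commute:
  fixes X Y :: "'a :: comm_semiring_0 mat"
  assumes "X \<in> carrier_mat n n" "Y \<in> carrier_mat n n"
  shows "(\<Sum>i<n. (X * Y) $$ (i, i)) = (\<Sum>i<n. (Y * X) $$ (i, i))"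
proof -
  have "(\<Sum>i<n. (X * Y) $$ (i, i)) = (\<Sum>i<n. \<Sum>j<n. X $$ (i, j) * Y $$ (j, i))"
    using assms by (simp add: scalar_prod_def atLeast0LessThan)
  also have "\<dots> = (\<Sum>j<n. \<Sum>i<n. Y $$ (j, i) * X $$ (i, j))"
    by (subst sum.swap) (simp add: mult.commute)
  also have "\<dots> = (\<Sum>i<n. (Y * X) $$ (i, i))"
    using assms by (simp add: scalar_prod_def atLeast0LessThan)
  finally show ?thesis .
qed

text \<open>
  A Schur triangularization \<open>M = P T Q\<close> with \<open>Q P = 1\<close> has the eigenvalues of \<open>M\<close>, with
  multiplicity, on the diagonal of \<open>T\<close>, and cyclicity of the trace gives
  \<open>tr T = tr (Q (P T)) = tr ((P T) Q) = tr M\<close>.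
\<close>

lemma sum_eigvals_eq_trace:
  assumes M: "M \<in> carrier_mat n n"
  shows "(\<Sum>l\<in>#eigvals_mset M. l) = (\<Sum>i<n. M $$ (i, i))"
proof -
  obtain es where es: "char_poly M = (\<Prod>a\<leftarrow>es. [:- a, 1:])" "length es = n"
    using char_poly_factorized[OF M] by blast
  obtain T P Q where TPQ: "schur_decomposition M es = (T, P, Q)"
    by (cases "schur_decomposition M es") auto
  note schur = schur_decomposition[OF M es(1) TPQ]
  have T: "T \<in> carrier_mat n n" and P: "P \<in> carrier_mat n n" and Q: "Q \<in> carrier_mat n n"
    and PTQ: "M = P * T * Q" and QP: "Q * P = 1\<^sub>m n"
    using schur M by (auto simp: similar_mat_wit_def Let_def)
  have "proots (\<Prod>a\<leftarrow>as. [:- a, 1:]) = mset as" for as :: "complex list"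
  proof (induction as)
    case (Cons a as)
    have "(\<Prod>a\<leftarrow>as. [:- a, 1:]) \<noteq> 0"
      by (auto simp: prod_list_zero_iff)
    thus ?case
      using Cons.IH by (simp add: proots_mult del: mult_pCons_left)
  qed simp
  hence "eigvals_mset M = mset es"
    by (simp add: eigvals_mset_def es(1))
  hence "(\<Sum>l\<in>#eigvals_mset M. l) = sum_list (diag_mat T)"
    using schur by (simp add: sum_mset_sum_list)
  also have "\<dots> = (\<Sum>i<n. T $$ (i, i))"
    using T by (simp add: diag_mat_def sum_list_sum_nth atLeast0LessThan)
  also have "T = Q * (P * T)"
    using assoc_mult_mat[OF Q P T] QP T by simp
  also have "(\<Sum>i<n. (Q * (P * T)) $$ (i, i)) = (\<Sum>i<n. (P * T * Q) $$ (i, i))"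
    using P T Q by (intro sum_diag_mult_commute) auto
  finally show ?thesis
    using PTQ by simp
qed

lemma Im_trace_le_max_Im_eigval:
  assumes M: "M \<in> carrier_mat n n"
  shows "Im (\<Sum>i<n. M $$ (i, i)) \<le> real n * max_Im_eigval M"
proof -
  have "Im (\<Sum>l\<in>#S. l) = (\<Sum>l\<in>#S. Im l)" for S
    by (induction S) simp_all
  hence "Im (\<Sum>i<n. M $$ (i, i)) = (\<Sum>l\<in>#eigvals_mset M. Im l)"
    by (simp only: sum_eigvals_eq_trace[OF M, symmetric])
  also have "\<dots> \<le> (\<Sum>l\<in>#eigvals_mset M. max_Im_eigval M)"
    using Im_eigval_le_max by (intro sum_mset_mono) blast
  also have "\<dots> = real n * max_Im_eigval M"
    using size_eigvals_mset[OF M] by simp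
  finally show ?thesis .
qed

section \<open>Rank-one perturbations\<close>

locale rank_one_perturbation =
  fixes A B :: "complex mat" and e :: "complex Matrix.vec" and n :: nat
  assumes A: "A \<in> carrier_mat n n" and self_adjoint: "mat_adjoint A = A"
    and e: "e \<in> carrier_vec n" and unit: "cvec_norm e = 1"
    and B: "B \<in> carrier_mat n n"
    and B_apply: "f \<in> carrier_vec n \<Longrightarrow> B *\<^sub>v f = (f \<bullet>c e) \<cdot>\<^sub>v e"
begin

lemma perturbed_carrier: "A + \<gamma> \<cdot>\<^sub>m B \<in> carrier_mat n n"
  using A B by simp

lemma trace_B: "(\<Sum>i<n. B $$ (i, i)) = 1"
proof -
  have "B $$ (i, i) = e $ i * cnj (e $ i)" if i: "i < n" for i
  proof -
    have "B $$ (i, i) = (B *\<^sub>v unit_vec n i) $ i"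
      using i B by (simp add: row_def)
    also have "\<dots> = (unit_vec n i \<bullet>c e) * e $ i"
      using i e by (simp add: B_apply)
    also have "unit_vec n i \<bullet>c e = cnj (e $ i)"
      using i e scalar_prod_left_unit[of "conjugate e" n i] by simp
    finally show ?thesis
      by simp
  qed
  hence "(\<Sum>i<n. B $$ (i, i)) = e \<bullet>c e"
    using e by (simp add: scalar_prod_def atLeast0LessThan)
  thus ?thesis
    by (simp add: cscalar_prod_self unit)
qed

lemma max_Im_eigval_ge:
  assumes "n \<ge> 1"
  shows "Im \<gamma> / real n \<le> max_Im_eigval (A + \<gamma> \<cdot>\<^sub>m B)"
proof -
  have diag: "Im (A $$ (i, i)) = 0" if "i < n" for i
    using self_adjoint_entries[OF A self_adjoint that that] by (metis cnj.sel(2) neg_equal_zero)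
  have "(\<Sum>i<n. (A + \<gamma> \<cdot>\<^sub>m B) $$ (i, i)) = (\<Sum>i<n. A $$ (i, i)) + \<gamma> * (\<Sum>i<n. B $$ (i, i))"
    using A B by (simp add: sum.distrib sum_distrib_left)
  hence "Im (\<Sum>i<n. (A + \<gamma> \<cdot>\<^sub>m B) $$ (i, i)) = Im \<gamma>"
    by (simp add: trace_B diag)
  thus ?thesis
    using Im_trace_le_max_Im_eigval[OF perturbed_carrier, of \<gamma>] assms by (simp add: field_simps)
qed

text \<open>
  The eigenvector equation is solved for \<open>A f\<close>, which makes it an instance of the equation
  \<open>A u = z u + f\<close> that the resolvent lemmas are about.
\<close>

lemma eigenvectorE:
  assumes "eigenvalue (A + \<gamma> \<cdot>\<^sub>m B) l"
  obtains f where "f \<in> carrier_vec n" "cvec_norm f \<noteq> 0"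
    "A *\<^sub>v f = l \<cdot>\<^sub>v f + (- \<gamma> * (f \<bullet>c e)) \<cdot>\<^sub>v e"
proof -
  obtain f where f: "f \<in> carrier_vec n" "f \<noteq> 0\<^sub>v n" "(A + \<gamma> \<cdot>\<^sub>m B) *\<^sub>v f = l \<cdot>\<^sub>v f"
    using assms A B unfolding eigenvalue_def eigenvector_def by auto
  have "(\<gamma> \<cdot>\<^sub>m B) *\<^sub>v f = \<gamma> \<cdot>\<^sub>v (B *\<^sub>v f)"
    using B f(1) by (rule smult_mat_mult_vec)
  hence "l \<cdot>\<^sub>v f = A *\<^sub>v f + \<gamma> \<cdot>\<^sub>v ((f \<bullet>c e) \<cdot>\<^sub>v e)"
    using add_mult_distrib_mat_vec[OF A _ f(1), of "\<gamma> \<cdot>\<^sub>m B"] B f B_apply by simp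
  hence "A *\<^sub>v f = l \<cdot>\<^sub>v f + (- \<gamma> * (f \<bullet>c e)) \<cdot>\<^sub>v e"
    using A f(1) e by (auto simp: smult_smult_assoc)
  thus thesis
    using that f cvec_norm_eq_0_iff by blast
qed

text \<open>
  Pairing the eigenvector equation with \<open>f\<close> gives
  \<open>\<lambda> \<parallel>f\<parallel>\<^sup>2 = \<langle>Af, f\<rangle> + \<gamma> \<bar>\<langle>f, e\<rangle>\<bar>\<^sup>2\<close>; both terms are bounded by Cauchy-Schwarz.
\<close>

lemma cmod_eigenvalue_le:
  assumes ev: "eigenvalue (A + \<gamma> \<cdot>\<^sub>m B) l"
  shows "cmod l \<le> mat_opnorm A + cmod \<gamma>"
proof -
  obtain f where f: "f \<in> carrier_vec n" "cvec_norm f \<noteq> 0"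
    and Af: "A *\<^sub>v f = l \<cdot>\<^sub>v f + (- \<gamma> * (f \<bullet>c e)) \<cdot>\<^sub>v e"
    using eigenvectorE[OF ev] .
  have Af_carrier: "A *\<^sub>v f \<in> carrier_vec n"
    using A f(1) by simp
  have "(A *\<^sub>v f) \<bullet>c f = l * (f \<bullet>c f) + (- \<gamma> * (f \<bullet>c e)) * (e \<bullet>c f)"
    unfolding Af using f(1) e by (simp add: add_scalar_prod_distrib[of _ n])
  hence "l * of_real ((cvec_norm f)\<^sup>2) = (A *\<^sub>v f) \<bullet>c f + \<gamma> * (f \<bullet>c e) * (e \<bullet>c f)"
    by (simp add: cscalar_prod_self)
  hence "cmod l * (cvec_norm f)\<^sup>2 = cmod ((A *\<^sub>v f) \<bullet>c f + \<gamma> * (f \<bullet>c e) * (e \<bullet>c f))"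
    by (metis norm_mult norm_of_real abs_power2)
  also have "\<dots> \<le> cmod ((A *\<^sub>v f) \<bullet>c f) + cmod \<gamma> * (cmod (f \<bullet>c e) * cmod (e \<bullet>c f))"
    using norm_triangle_ineq[of "(A *\<^sub>v f) \<bullet>c f" "\<gamma> * (f \<bullet>c e) * (e \<bullet>c f)"]
    by (simp add: norm_mult mult.assoc)
  also have "cmod ((A *\<^sub>v f) \<bullet>c f) \<le> (mat_opnorm A * cvec_norm f) * cvec_norm f"
    using cscalar_prod_Cauchy_Schwarz[OF Af_carrier f(1)]
      mult_right_mono[OF cvec_norm_mult_mat_vec_le[OF A f(1)] cvec_norm_nonneg[of f]]
    by linarith
  also have "cmod \<gamma> * (cmod (f \<bullet>c e) * cmod (e \<bullet>c f)) \<le> cmod \<gamma> * (cvec_norm f * cvec_norm f)"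
    using cscalar_prod_Cauchy_Schwarz[OF f(1) e] cscalar_prod_Cauchy_Schwarz[OF e f(1)] unit
    by (intro mult_left_mono mult_mono) auto
  finally have "cmod l * (cvec_norm f)\<^sup>2 \<le> (mat_opnorm A + cmod \<gamma>) * (cvec_norm f)\<^sup>2"
    by (simp add: power2_eq_square algebra_simps)
  thus ?thesis
    using f(2) by (simp add: mult_le_cancel_right)
qed

text \<open>
  Since \<open>f = -\<gamma>\<langle>f, e\<rangle>(A - \<lambda>)\<^sup>-\<^sup>1 e\<close>, pairing with \<open>e\<close> gives
  \<open>\<langle>f, e\<rangle> = -\<gamma>\<langle>f, e\<rangle> m(\<lambda>)\<close>. The factor \<open>\<langle>f, e\<rangle>\<close> can be cancelled: if it vanished, then
  \<open>f\<close> would be an eigenvector of \<open>A\<close> itself for the non-real number \<open>\<lambda>\<close>.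
\<close>

lemma resolvent_form_eigenvalue:
  assumes ev: "eigenvalue (A + \<gamma> \<cdot>\<^sub>m B) l" and l: "Im l \<noteq> 0"
  shows "resolvent_form A e l = - 1 / \<gamma>"
proof -
  obtain f where f: "f \<in> carrier_vec n" "cvec_norm f \<noteq> 0"
    and Af: "A *\<^sub>v f = l \<cdot>\<^sub>v f + (- \<gamma> * (f \<bullet>c e)) \<cdot>\<^sub>v e"
    using eigenvectorE[OF ev] .
  let ?R = "the (mat_inverse (A - l \<cdot>\<^sub>m 1\<^sub>m n))"
  have R: "?R \<in> carrier_mat n n"
    using self_adjoint_shift_inverse(1)[OF A self_adjoint l] .
  \<comment> \<open>The resolvent bound excludes \<open>\<gamma>\<langle>f, e\<rangle> = 0\<close>, and with it \<open>\<gamma> = 0\<close>.\<close>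
  have "\<bar>Im l\<bar> * cvec_norm f \<le> cmod (\<gamma> * (f \<bullet>c e))"
    using self_adjoint_resolvent_bound[OF A self_adjoint f(1) _ Af] e unit
    by (simp add: cvec_norm_smult norm_mult)
  moreover have "\<bar>Im l\<bar> * cvec_norm f > 0"
    using l f(2) cvec_norm_nonneg[of f] by (intro mult_pos_pos) linarith+
  ultimately have nz: "\<gamma> * (f \<bullet>c e) \<noteq> 0"
    by auto
  have "A *\<^sub>v f - l \<cdot>\<^sub>v f = (- \<gamma> * (f \<bullet>c e)) \<cdot>\<^sub>v e"
    unfolding Af using f(1) e by auto
  hence "f = ?R *\<^sub>v ((- \<gamma> * (f \<bullet>c e)) \<cdot>\<^sub>v e)"
    using resolvent_vec_unique[OF A self_adjoint l f(1)] by simp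
  also have "\<dots> = (- \<gamma> * (f \<bullet>c e)) \<cdot>\<^sub>v (?R *\<^sub>v e)"
    using R e by (rule mult_mat_vec)
  finally have "f \<bullet>c e = (- \<gamma> * (f \<bullet>c e)) * resolvent_form A e l"
    using R e A by (metis resolvent_form_def carrier_matD(1) smult_scalar_prod_distrib
        mult_mat_vec_carrier carrier_vec_conjugate)
  hence "(f \<bullet>c e) - (- \<gamma> * (f \<bullet>c e)) * resolvent_form A e l = 0"
    by (subst right_minus_eq)
  hence "(f \<bullet>c e) * (\<gamma> * resolvent_form A e l + 1) = 0"
    by (simp add: algebra_simps)
  hence "\<gamma> * resolvent_form A e l = - 1"
    using nz by (simp add: eq_neg_iff_add_eq_0)
  thus ?thesis
    using nz by (simp add: field_simps)
qed

end

section \<open>The limit of the largest imaginary part\<close>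

text \<open>
  A common Lipschitz constant turns convergence at the single point \<open>l\<close> into convergence along
  points that tend to \<open>l\<close>.
\<close>

lemma limit_along_convergent_points:
  fixes m :: "nat \<Rightarrow> complex \<Rightarrow> complex"
  assumes Lipschitz: "\<And>k z w. z \<in> K \<Longrightarrow> w \<in> K \<Longrightarrow> cmod (m k z - m k w) \<le> C * cmod (z - w)"
    and pointwise: "(\<lambda>k. m k l) \<longlonglongrightarrow> a"
    and points: "\<And>k. x k \<in> K" "l \<in> K" "x \<longlonglongrightarrow> l"
  shows "(\<lambda>k. m k (x k)) \<longlonglongrightarrow> a"
proof -
  have "(\<lambda>k. C * cmod (x k - l)) \<longlonglongrightarrow> C * cmod (l - l)"
    by (intro tendsto_intros points(3))
  hence "(\<lambda>k. C * cmod (x k - l)) \<longlonglongrightarrow> 0"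
    by simp
  hence "(\<lambda>k. m k (x k) - m k l) \<longlonglongrightarrow> 0"
    by (rule Lim_null_comparison[rotated]) (intro always_eventually allI Lipschitz points)
  hence "(\<lambda>k. (m k (x k) - m k l) + m k l) \<longlonglongrightarrow> 0 + a"
    using pointwise by (rule tendsto_add)
  thus ?thesis
    by simp
qed

theorem theorem39:
  fixes A B :: "nat \<Rightarrow> complex mat" and e :: "nat \<Rightarrow> complex Matrix.vec"
  assumes A_carrier: "\<And>N. N \<ge> 1 \<Longrightarrow> A N \<in> carrier_mat N N"
    and A_selfadjoint: "\<And>N. N \<ge> 1 \<Longrightarrow> mat_adjoint (A N) = A N"
    and e_carrier: "\<And>N. N \<ge> 1 \<Longrightarrow> e N \<in> carrier_vec N"
    and e_unit: "\<And>N. N \<ge> 1 \<Longrightarrow> cvec_norm (e N) = 1"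
    and B_carrier: "\<And>N. N \<ge> 1 \<Longrightarrow> B N \<in> carrier_mat N N"
    and B_apply: "\<And>N f. N \<ge> 1 \<Longrightarrow> f \<in> carrier_vec N \<Longrightarrow> B N *\<^sub>v f = (f \<bullet>c e N) \<cdot>\<^sub>v e N"
  shows "(\<forall>N\<ge>1. \<forall>\<gamma>\<in>upper_half_plane. max_Im_eigval (A N + \<gamma> \<cdot>\<^sub>m B N) \<ge> Im \<gamma> / real N) \<and>
    (\<forall>(c::real) m_inf.
       (\<forall>N\<ge>1. mat_opnorm (A N) \<le> c) \<longrightarrow>
       locally_uniform_limit upper_half_plane
         (\<lambda>N z. (the (mat_inverse (A N - z \<cdot>\<^sub>m 1\<^sub>m N)) *\<^sub>v e N) \<bullet>c e N) m_inf \<longrightarrow>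
       (\<forall>\<gamma>\<in>upper_half_plane. - 1 / \<gamma> \<notin> m_inf ` upper_half_plane \<longrightarrow>
          (\<lambda>N. max_Im_eigval (A N + \<gamma> \<cdot>\<^sub>m B N)) \<longlonglongrightarrow> 0))"
  (is "?lower \<and> ?limit")
proof
  have rank_one: "rank_one_perturbation (A N) (B N) (e N) N" if "N \<ge> 1" for N
    using assms that by (simp add: rank_one_perturbation_def)
  show ?lower
    using rank_one_perturbation.max_Im_eigval_ge[OF rank_one] by blast
  show ?limit
  proof (intro allI impI ballI)
    fix c :: real and m_inf :: "complex \<Rightarrow> complex" and \<gamma> :: complex
    assume bound: "\<forall>N\<ge>1. mat_opnorm (A N) \<le> c"
      and lim: "locally_uniform_limit upper_half_plane
         (\<lambda>N z. (the (mat_inverse (A N - z \<cdot>\<^sub>m 1\<^sub>m N)) *\<^sub>v e N) \<bullet>c e N) m_inf"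
      and \<gamma>: "\<gamma> \<in> upper_half_plane" and not_in_range: "- 1 / \<gamma> \<notin> m_inf ` upper_half_plane"
    have pointwise: "(\<lambda>N. resolvent_form (A N) (e N) z) \<longlonglongrightarrow> m_inf z" if z: "Im z > 0" for z
    proof -
      obtain d where d: "d > 0" "uniform_limit (cball z d)
          (\<lambda>N z. (the (mat_inverse (A N - z \<cdot>\<^sub>m 1\<^sub>m N)) *\<^sub>v e N) \<bullet>c e N) m_inf sequentially"
        using lim z unfolding locally_uniform_limit_def upper_half_plane_def by blast
      have "(\<lambda>N. (the (mat_inverse (A N - z \<cdot>\<^sub>m 1\<^sub>m N)) *\<^sub>v e N) \<bullet>c e N) \<longlonglongrightarrow> m_inf z"
        using tendsto_uniform_limitI[OF d(2), of z] d(1) by simp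
      moreover have "\<forall>\<^sub>F N in sequentially.
          (the (mat_inverse (A N - z \<cdot>\<^sub>m 1\<^sub>m N)) *\<^sub>v e N) \<bullet>c e N = resolvent_form (A N) (e N) z"
        using eventually_ge_at_top[of 1]
        by eventually_elim (simp add: resolvent_form_def carrier_matD(1)[OF A_carrier])
      ultimately show ?thesis
        by (rule Lim_transform_eventually)
    qed
    \<comment> \<open>The guard \<open>N \<ge> 1\<close> is kept inside the eventual statement, so that every index of a
      subsequence violating it is one at which the hypotheses hold.\<close>
    have small: "\<forall>\<^sub>F N in sequentially. N \<ge> 1 \<longrightarrow> max_Im_eigval (A N + \<gamma> \<cdot>\<^sub>m B N) < \<epsilon>"
      if \<epsilon>: "\<epsilon> > 0" for \<epsilon>
    proof (rule ccontr)
      assume "\<not> ?thesis"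
      then obtain r :: "nat \<Rightarrow> nat" where r: "strict_mono r"
        and large: "\<And>k. r k \<ge> 1 \<and> max_Im_eigval (A (r k) + \<gamma> \<cdot>\<^sub>m B (r k)) \<ge> \<epsilon>"
        using not_eventually_sequentiallyD[of "\<lambda>N. N \<ge> 1 \<longrightarrow> max_Im_eigval (A N + \<gamma> \<cdot>\<^sub>m B N) < \<epsilon>"]
        unfolding not_imp not_less by blast
      have "\<exists>l. eigenvalue (A (r k) + \<gamma> \<cdot>\<^sub>m B (r k)) l \<and> Im l \<ge> \<epsilon>" for k
      proof -
        have rk: "r k \<ge> 1"
          using large by blast
        show ?thesis
          using max_Im_eigval_attained[OF
              rank_one_perturbation.perturbed_carrier[OF rank_one[OF rk]] rk] large by metis
      qed
      then obtain x where x: "\<And>k. eigenvalue (A (r k) + \<gamma> \<cdot>\<^sub>m B (r k)) (x k)" "\<And>k. Im (x k) \<ge> \<epsilon>"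
        by metis
      define K where "K = cball 0 (c + cmod \<gamma>) \<inter> {z. Im z \<ge> \<epsilon>}"
      have "compact K"
        unfolding K_def by (intro compact_Int_closed compact_cball closed_halfspace_Im_ge)
      moreover have xK: "x k \<in> K" for k
      proof -
        have rk: "r k \<ge> 1"
          using large by blast
        have "cmod (x k) \<le> mat_opnorm (A (r k)) + cmod \<gamma>"
          using rank_one_perturbation.cmod_eigenvalue_le[OF rank_one[OF rk] x(1)] .
        also have "\<dots> \<le> c + cmod \<gamma>"
          using bound rk by simp
        finally show ?thesis
          using x(2) by (simp add: K_def)
      qed
      ultimately obtain l s where l: "l \<in> K" and s: "strict_mono s" and conv: "(x \<circ> s) \<longlonglongrightarrow> l"
        unfolding compact_def by blast
      define q where "q = r \<circ> s"
      have q: "strict_mono q" "\<And>k. q k \<ge> 1"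
        using r s large by (auto simp: q_def intro: strict_mono_o)
      have "(\<lambda>k. resolvent_form (A (q k)) (e (q k)) ((x \<circ> s) k)) \<longlonglongrightarrow> m_inf l"
      proof (rule limit_along_convergent_points[where K = K and C = "1 / \<epsilon>\<^sup>2", OF _ _ _ l conv])
        fix k z w assume "z \<in> K" "w \<in> K"
        thus "cmod (resolvent_form (A (q k)) (e (q k)) z - resolvent_form (A (q k)) (e (q k)) w)
            \<le> 1 / \<epsilon>\<^sup>2 * cmod (z - w)"
          using resolvent_form_Lipschitz[OF A_carrier A_selfadjoint e_carrier e_unit, of "q k" \<epsilon> z w]
            q(2) \<epsilon> by (simp add: K_def)
      next
        show "(\<lambda>k. resolvent_form (A (q k)) (e (q k)) l) \<longlonglongrightarrow> m_inf l"
          using LIMSEQ_subseq_LIMSEQ[OF pointwise q(1), of l] l \<epsilon> by (simp add: K_def o_def)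
      qed (use xK in simp)
      moreover have "resolvent_form (A (q k)) (e (q k)) ((x \<circ> s) k) = - 1 / \<gamma>" for k
        using rank_one_perturbation.resolvent_form_eigenvalue[OF rank_one x(1), of "s k"]
          large[of "s k"] x(2)[of "s k"] \<epsilon> by (simp add: q_def)
      ultimately have "m_inf l = - 1 / \<gamma>"
        by (simp add: LIMSEQ_const_iff)
      moreover have "l \<in> upper_half_plane"
        using l \<epsilon> by (simp add: K_def upper_half_plane_def)
      ultimately show False
        using not_in_range by force
    qed
    show "(\<lambda>N. max_Im_eigval (A N + \<gamma> \<cdot>\<^sub>m B N)) \<longlonglongrightarrow> 0"
    proof (rule tendstoI)
      fix \<epsilon> :: real assume "\<epsilon> > 0"
      from small[OF this] eventually_ge_at_top[of 1]
      show "\<forall>\<^sub>F N in sequentially. dist (max_Im_eigval (A N + \<gamma> \<cdot>\<^sub>m B N)) 0 < \<epsilon>"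
      proof eventually_elim
        case (elim N)
        have "0 \<le> Im \<gamma> / real N"
          using \<gamma> by (simp add: upper_half_plane_def)
        also have "\<dots> \<le> max_Im_eigval (A N + \<gamma> \<cdot>\<^sub>m B N)"
          using \<open>?lower\<close> \<gamma> elim by blast
        finally show ?case
          using elim by simp
      qed
    qed
  qed
qed

end
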